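(* Let $\Omega\subset\mathbb{R}^n$ be a compact set with nonempty interior, let $\lambda$ be a finite Borel measure on $\Omega$ with $\operatorname{supp}\lambda=\Omega$ and with $\lambda(O)>0$ for some open set $O\subset\Omega$, and let $u\in L^2(\Omega,\lambda)$ be nonnegative. Fix $d\in\mathbb{N}$ and let $\mathbf{y}=(y_\alpha)_{\alpha\in\mathbb{N}^n_d}$ with $y_\alpha=\int_\Omega \mathbf{x}^\alpha u\,d\lambda$. Then a polynomial $u^*_d\in\mathbb{R}[\mathbf{x}]_d$ is an optimal solution of the problem $$\min_{u_d\in\mathbb{R}[\mathbf{x}]_d}\ \|u-u_d\|_2^2=\int_\Omega (u-u_d)^2\,d\lambda$$ if and only if its vector of coefficients $\mathbf{u}^*_d\in\mathbb{R}^{s(d)}$ (in the monomial basis) is an optimal solution of the unconstrained quadratic optimization problem $$\min_{\mathbf{u}_d\in\mathbb{R}^{s(d)}}\ \{\,\mathbf{u}_d^T\,\mathbf{M}_d(\mathbf{z})\,\mathbf{u}_d-2\,\mathbf{u}_d^T\mathbf{y}\,\}.$$ Moreover, $\mathbf{M}_d(\mathbf{z})$ is invertible, $\mathbf{u}^*_d:=\mathbf{M}_d(\mathbf{z})^{-1}\mathbf{y}$ is the unique optimal solution of the latter quadratic problem, and the corresponding polynomial $u^*_d\in\mathbb{R}[\mathbf{x}]_d$ satisfies $$\int_\Omega \mathbf{x}^\alpha u^*_d\,d\lambda=y_\alpha=\int_\Omega\mathbf{x}^\alpha u\,d\lambda,\qquad\forall\,\alpha\in\mathbb{N}^n_d.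$$
   Context: $\mathbb{R}[\mathbf{x}]_d$ is the space of real polynomials in $\mathbf{x}=(x_1,\dots,x_n)$ of degree at most $d$. $\mathbb{N}^n_d=\{\alpha\in\mathbb{N}^n:\sum_j\alpha_j\le d\}$, of cardinality $s(d)=\binom{n+d}{d}$, and $\mathbf{x}^\alpha=x_1^{\alpha_1}\cdots x_n^{\alpha_n}$. A polynomial $f=\sum_{\alpha\in\mathbb{N}^n_d} f_\alpha\mathbf{x}^\alpha$ is identified with its coefficient vector $(f_\alpha)\in\mathbb{R}^{s(d)}$. $\|\cdot\|_2$ is the norm of $L^2(\Omega,\lambda)$. $\mathbf{z}=(z_\alpha)_{\alpha\in\mathbb{N}^n}$ is the moment sequence of $\lambda$, $z_\alpha=\int_\Omega\mathbf{x}^\alpha\,d\lambda$. The moment matrix $\mathbf{M}_d(\mathbf{z})$ is the real symmetric matrix with rows and columns indexed by $\mathbb{N}^n_d$ whose $(\alpha,\beta)$ entry is $z_{\alpha+\beta}$. The support of a measure is taken in the usual topological sense. The function $u$ is the density with respect to $\lambda$ of a measure $\mu$ on $\Omega$ (i.e. $d\mu=u\,d\lambda$). *)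

theory Defs
  imports
    "HOL-Analysis.Analysis"
    "HOL-Library.Poly_Mapping"
    "Jordan_Normal_Form.Gauss_Jordan_Elimination"
begin

(* In this development "$" is indexing of Jordan_Normal_Form vectors;
   coordinates of points of real^'n are written vec_nth x i. *)
unbundle no vec_syntax

text \<open>
  Exponents \<alpha> are of type \<^typ>\<open>'n \<Rightarrow>\<^sub>0 nat\<close> with \<^typ>\<open>'n\<close> the finite index type of the variables,
  and real polynomials in these variables are the finitely supported coefficient families
  \<^typ>\<open>('n \<Rightarrow>\<^sub>0 nat) \<Rightarrow>\<^sub>0 real\<close>.
\<close>

type_synonym 'n exponent = "'n \<Rightarrow>\<^sub>0 nat"
type_synonym 'n rpoly = "('n \<Rightarrow>\<^sub>0 nat) \<Rightarrow>\<^sub>0 real"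

definition exponents_le :: "nat \<Rightarrow> ('n::finite) exponent set" where
  "exponents_le d = {\<alpha>. (\<Sum>j\<in>UNIV. Poly_Mapping.lookup \<alpha> j) \<le> d}"

definition polys_le :: "nat \<Rightarrow> ('n::finite) rpoly set" where
  "polys_le d = {p. Poly_Mapping.keys p \<subseteq> exponents_le d}"

definition monom_eval :: "('n::finite) exponent \<Rightarrow> real ^ 'n \<Rightarrow> real" where
  "monom_eval \<alpha> x = (\<Prod>j\<in>UNIV. vec_nth x j ^ Poly_Mapping.lookup \<alpha> j)"

definition poly_eval :: "('n::finite) rpoly \<Rightarrow> real ^ 'n \<Rightarrow> real" where
  "poly_eval p x = (\<Sum>\<alpha>\<in>Poly_Mapping.keys p. Poly_Mapping.lookup p \<alpha> * monom_eval \<alpha> x)"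

text \<open>
  A family indexed by exponents becomes a vector or matrix in the sense of
  \<^theory>\<open>Jordan_Normal_Form.Matrix\<close> once the exponents are listed in some order \<open>as\<close>.
  Below \<open>as\<close> is any list enumerating \<^term>\<open>exponents_le d\<close> without repetition, so that
  \<^term>\<open>length as\<close> is the dimension (see \<open>length_exponents_enum\<close>).
\<close>

definition family_vec :: "('n exponent) list \<Rightarrow> ('n exponent \<Rightarrow> real) \<Rightarrow> real vec" where
  "family_vec as f = vec (length as) (\<lambda>i. f (as ! i))"

definition coeff_vec :: "('n exponent) list \<Rightarrow> 'n rpoly \<Rightarrow> real vec" where
  "coeff_vec as p = family_vec as (Poly_Mapping.lookup p)"

definition moment_matrix :: "('n exponent) list \<Rightarrow> ('n exponent \<Rightarrow> real) \<Rightarrow> real mat" where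
  "moment_matrix as z = mat (length as) (length as) (\<lambda>(i, j). z (as ! i + as ! j))"

definition moment :: "(real ^ 'n) measure \<Rightarrow> ('n::finite) exponent \<Rightarrow> real" where
  "moment M \<alpha> = (\<integral>x. monom_eval \<alpha> x \<partial>M)"

definition quad_objective :: "real mat \<Rightarrow> real vec \<Rightarrow> real vec \<Rightarrow> real" where
  "quad_objective A b v = v \<bullet> (A *\<^sub>v v) - 2 * (v \<bullet> b)"

definition square_integrable :: "'a measure \<Rightarrow> ('a \<Rightarrow> real) \<Rightarrow> bool" where
  "square_integrable M f \<longleftrightarrow> f \<in> borel_measurable M \<and> integrable M (\<lambda>x. (f x)\<^sup>2)"

definition L2_norm :: "'a measure \<Rightarrow> ('a \<Rightarrow> real) \<Rightarrow> real" where
  "L2_norm M f = sqrt (\<integral>x. (f x)\<^sup>2 \<partial>M)"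

(* The space of M may be a proper subset of the type; neighbourhoods are taken relative to it. *)
definition measure_support :: "('a::topological_space) measure \<Rightarrow> 'a set" where
  "measure_support M =
     {x \<in> space M. \<forall>U. open U \<longrightarrow> x \<in> U \<longrightarrow> 0 < emeasure M (U \<inter> space M)}"

lemma L2_norm_squared: "(L2_norm M f)\<^sup>2 = (\<integral>x. (f x)\<^sup>2 \<partial>M)"
  by (simp add: L2_norm_def)

lemma card_exponents_le:
  "finite (exponents_le d :: ('n::finite) exponent set)"
  "card (exponents_le d :: ('n::finite) exponent set) = (CARD('n) + d) choose d"
proof -
  obtain js :: "'n list" where js: "set js = UNIV" "distinct js"
    using finite_distinct_list[OF finite] by blast
  have len: "length js = CARD('n)"
    using js distinct_card by metis
  define S :: "nat list set" where "S = {l. length l = Suc (length js) \<and> sum_list l = d}"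
  define F :: "'n exponent \<Rightarrow> nat list"
    where "F \<alpha> = (d - (\<Sum>j\<in>UNIV. Poly_Mapping.lookup \<alpha> j)) # map (Poly_Mapping.lookup \<alpha>) js" for \<alpha>
  have sum_js: "sum_list (map f js) = (\<Sum>j\<in>UNIV. f j)" for f :: "'n \<Rightarrow> nat"
    using js by (metis sum_list_distinct_conv_sum_set)
  have inj: "inj_on F (exponents_le d)"
  proof (rule inj_onI)
    fix \<alpha> \<beta> assume "F \<alpha> = F \<beta>"
    then have "\<forall>j\<in>set js. Poly_Mapping.lookup \<alpha> j = Poly_Mapping.lookup \<beta> j"
      by (simp add: F_def)
    then show "\<alpha> = \<beta>" using js by (intro poly_mapping_eqI) auto
  qed
  have "F ` exponents_le d = S"
  proof (intro equalityI subsetI)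
    fix l assume "l \<in> F ` exponents_le d"
    then show "l \<in> S" by (auto simp: F_def S_def exponents_le_def sum_js)
  next
    fix l assume "l \<in> S"
    then obtain a m where l: "l = a # m" "length m = length js" "a + sum_list m = d"
      by (cases l) (auto simp: S_def)
    define \<alpha> :: "'n exponent" where "\<alpha> = Abs_poly_mapping (\<lambda>j. the (map_of (zip js m) j))"
    have look: "Poly_Mapping.lookup \<alpha> = (\<lambda>j. the (map_of (zip js m) j))"
      unfolding \<alpha>_def by (rule Abs_poly_mapping_inverse) simp
    have m: "map (Poly_Mapping.lookup \<alpha>) js = m"
      unfolding look using l(2) js(2)
      by (intro nth_equalityI) (auto simp: map_of_zip_nth)
    then have "(\<Sum>j\<in>UNIV. Poly_Mapping.lookup \<alpha> j) = sum_list m"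
      using sum_js by metis
    then show "l \<in> F ` exponents_le d"
      using l m by (intro image_eqI[of _ _ \<alpha>]) (auto simp: F_def exponents_le_def)
  qed
  then have bij: "bij_betw F (exponents_le d) S"
    using inj by (simp add: bij_betw_def)
  have "card S = (d + Suc (length js) - 1) choose d"
    unfolding S_def by (rule card_length_sum_list)
  then have card_S: "card S = (CARD('n) + d) choose d"
    by (simp add: len add.commute)
  then show "card (exponents_le d :: 'n exponent set) = (CARD('n) + d) choose d"
    using bij_betw_same_card[OF bij] by simp
  have "card S > 0" using card_S by simp
  then show "finite (exponents_le d :: 'n exponent set)"
    using bij_betw_finite[OF bij] card_gt_0_iff by blast
qed

lemma exponents_enum_exists:
  "\<exists>as :: ('n::finite) exponent list. distinct as \<and> set as = exponents_le d"
  using finite_distinct_list[OF card_exponents_le(1)] by blast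

lemma length_exponents_enum:
  assumes "distinct as" "set as = (exponents_le d :: ('n::finite) exponent set)"
  shows "length as = (CARD('n) + d) choose d"
  using assms card_exponents_le(2) distinct_card by metis

lemma bij_betw_coeff_vec:
  assumes "distinct as" "set as = (exponents_le d :: ('n::finite) exponent set)"
  shows "bij_betw (coeff_vec as) (polys_le d) (carrier_vec (length as))"
proof (rule bij_betw_imageI)
  show "inj_on (coeff_vec as) (polys_le d)"
  proof (rule inj_onI)
    fix p q assume pq: "p \<in> polys_le d" "q \<in> polys_le d" "coeff_vec as p = coeff_vec as q"
    show "p = q"
    proof (rule poly_mapping_eqI)
      fix \<alpha>
      show "Poly_Mapping.lookup p \<alpha> = Poly_Mapping.lookup q \<alpha>"
      proof (cases "\<alpha> \<in> exponents_le d")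
        case True
        then obtain i where i: "i < length as" "as ! i = \<alpha>"
          using assms(2) by (metis in_set_conv_nth)
        have "coeff_vec as p $ i = coeff_vec as q $ i" using pq(3) by simp
        then show ?thesis using i by (simp add: coeff_vec_def family_vec_def)
      next
        case False
        then have "\<alpha> \<notin> Poly_Mapping.keys p" "\<alpha> \<notin> Poly_Mapping.keys q"
          using pq by (auto simp: polys_le_def)
        then show ?thesis by (simp add: in_keys_iff)
      qed
    qed
  qed
  show "coeff_vec as ` polys_le d = carrier_vec (length as)"
  proof (intro equalityI subsetI)
    fix v assume "v \<in> coeff_vec as ` polys_le d"
    then show "v \<in> carrier_vec (length as)"
      by (auto simp: coeff_vec_def family_vec_def)
  next
    fix v :: "real vec" assume v: "v \<in> carrier_vec (length as)"
    define f where "f \<alpha> = (case map_of (zip as [0..<length as]) \<alpha> of None \<Rightarrow> 0 | Some i \<Rightarrow> v $ i)" for \<alpha>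
    define p where "p = Abs_poly_mapping f"
    have supp: "{\<alpha>. f \<alpha> \<noteq> 0} \<subseteq> set as"
      by (auto simp: f_def split: option.splits dest!: map_of_SomeD set_zip_leftD)
    then have "finite {\<alpha>. f \<alpha> \<noteq> 0}" using finite_subset by blast
    then have look: "Poly_Mapping.lookup p = f"
      unfolding p_def by (intro Abs_poly_mapping_inverse) simp
    have "p \<in> polys_le d"
      using supp assms(2) by (auto simp: polys_le_def in_keys_iff look)
    moreover have "f (as ! i) = v $ i" if "i < length as" for i
      using map_of_zip_nth[of as "[0..<length as]" i] assms(1) that by (simp add: f_def)
    then have "coeff_vec as p = v"
      using v by (intro eq_vecI) (auto simp: coeff_vec_def family_vec_def look)
    ultimately show "v \<in> coeff_vec as ` polys_le d" by blast
  qed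
qed

end

theory Submission
  imports Defs "Jordan_Normal_Form.Determinant"
begin

text \<open>
  The moment matrix is the Gram matrix of the monomials in \<open>L\<^sup>2\<close>: if \<open>v\<close> is the coefficient vector
  of \<open>p\<close>, the entries of \<open>M v\<close> are the integrals of \<open>x\<^sup>\<alpha> p\<close>, and \<open>v \<bullet> M v\<close> is the integral of
  \<open>p\<^sup>2\<close> (\<open>moment_matrix_mult_coeff_vec\<close>, \<open>moment_matrix_quadratic_form\<close>). Expanding the square,
  the squared distance from \<open>u\<close> to \<open>p\<close> equals the quadratic objective at \<open>v\<close> plus the constant
  \<open>\<integral>u\<^sup>2\<close> (\<open>L2_distance_eq_quad_objective\<close>). As polynomials of degree at most \<open>d\<close> correspond
  bijectively to coefficient vectors, the two problems have the same minimizers.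

  Everything else follows once \<open>M\<close> is positive definite, that is, once \<open>\<integral>p\<^sup>2 = 0\<close> forces \<open>p = 0\<close>.
  Two facts give this. A continuous function whose square integrates to zero vanishes at each
  point of the support (\<open>zero_on_measure_support\<close>); the support is \<open>\<Omega>\<close>, which contains a
  nonempty open set, and a polynomial that vanishes on such a set has zero coefficients
  (\<open>poly_zero_on_open\<close>). A positive definite \<open>M\<close> is invertible, and completing the square around
  the solution \<open>c\<close> of \<open>M c = y\<close> shows that \<open>c\<close> is the unique minimizer
  (\<open>positive_definite_unique_minimizer\<close>). Read entry by entry, \<open>M c = y\<close> says that the polynomial
  with coefficients \<open>c\<close> has the same moments as \<open>u\<close> up to degree \<open>d\<close>.
\<close>

section \<open>Polynomial functions\<close>

lemma monom_eval_add: "monom_eval (\<alpha> + \<beta>) x = monom_eval \<alpha> x * monom_eval \<beta> x"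
  by (simp add: monom_eval_def lookup_add power_add prod.distrib)

lemma continuous_on_monom_eval [continuous_intros]: "continuous_on S (monom_eval \<alpha>)"
  unfolding monom_eval_def by (intro continuous_intros)

lemma continuous_on_poly_eval [continuous_intros]: "continuous_on S (poly_eval p)"
  unfolding poly_eval_def by (intro continuous_intros)

lemma poly_eval_superset:
  assumes "finite A" "Poly_Mapping.keys p \<subseteq> A"
  shows "poly_eval p x = (\<Sum>\<alpha>\<in>A. Poly_Mapping.lookup p \<alpha> * monom_eval \<alpha> x)"
  unfolding poly_eval_def using assms
  by (intro sum.mono_neutral_left) (auto simp: in_keys_iff)

text \<open>
  Uniqueness of base-\<open>K\<close> digits. It lets one weighted degree tell apart the finitely many
  exponents of a polynomial, which is what reduces several variables to one.
\<close>

lemma digit_sum_inject: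
  fixes f g :: "nat \<Rightarrow> nat"
  assumes "\<And>i. i < n \<Longrightarrow> f i < K" "\<And>i. i < n \<Longrightarrow> g i < K"
    and "(\<Sum>i<n. K ^ i * f i) = (\<Sum>i<n. K ^ i * g i)" and "i < n"
  shows "f i = g i"
  using assms
proof (induction n arbitrary: f g i)
  case 0
  then show ?case by simp
next
  case (Suc n)
  have split: "(\<Sum>i<Suc n. K ^ i * h i) = h 0 + K * (\<Sum>i<n. K ^ i * h (Suc i))" for h :: "nat \<Rightarrow> nat"
    by (subst sum.lessThan_Suc_shift) (simp add: sum_distrib_left mult.assoc)
  have eq: "f 0 + K * (\<Sum>i<n. K ^ i * f (Suc i)) = g 0 + K * (\<Sum>i<n. K ^ i * g (Suc i))"
    using Suc.prems(3) unfolding split .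
  have lt: "f 0 < K" "g 0 < K" using Suc.prems(1,2) by auto
  have zero: "f 0 = g 0"
    using arg_cong[OF eq, of "\<lambda>m. m mod K"] lt by simp
  then have "(\<Sum>i<n. K ^ i * f (Suc i)) = (\<Sum>i<n. K ^ i * g (Suc i))"
    using eq lt by simp
  then have "f (Suc k) = g (Suc k)" if "k < n" for k
    using Suc.IH[of "\<lambda>i. f (Suc i)" "\<lambda>i. g (Suc i)" k] Suc.prems(1,2) that by auto
  then show ?case using zero Suc.prems(4) by (cases i) auto
qed

text \<open>
  Move a point of \<open>U\<close> along the diagonal direction: an open, hence infinite, set of
  parameters stays in \<open>U\<close>, and each coordinate vanishes for only one parameter.
\<close>

lemma open_meets_nonzero_coordinates:
  fixes U :: "(real ^ 'n::finite) set"
  assumes "open U" "U \<noteq> {}"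
  obtains a where "a \<in> U" "\<And>j. vec_nth a j \<noteq> 0"
proof -
  obtain c where c: "c \<in> U" using assms(2) by blast
  define line where "line t = vec_lambda (\<lambda>j. vec_nth c j + t)" for t :: real
  have "continuous_on UNIV line"
    unfolding line_def by (intro continuous_intros)
  then have "open (line -` U)"
    using assms(1) by (simp add: open_vimage)
  moreover have "line 0 = c" by (simp add: line_def vec_eq_iff)
  then have "0 \<in> line -` U" using c by simp
  ultimately have "infinite (line -` U)"
    using finite_imp_not_open by blast
  then have "infinite (line -` U - range (\<lambda>j. - vec_nth c j))"
    by (intro Diff_infinite_finite) auto
  then obtain t where t: "t \<in> line -` U" "t \<notin> range (\<lambda>j. - vec_nth c j)"
    by (metis DiffE ex_in_conv finite.emptyI)
  show thesis
  proof
    show "line t \<in> U" using t by simp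
    show "vec_nth (line t) j \<noteq> 0" for j
      using t(2) by (auto simp: line_def add_eq_0_iff)
  qed
qed

text \<open>
  Restrict \<open>p\<close> to a monomial curve \<open>t \<mapsto> (a\<^sub>j t\<^bsup>w(j)\<^esup>)\<close> that passes through a point \<open>a\<close> of \<open>U\<close> at
  \<open>t = 1\<close>. The term with exponent \<open>\<alpha>\<close> becomes \<open>p\<^sub>\<alpha> a\<^sup>\<alpha> t\<^bsup>N(\<alpha>)\<^esup>\<close> with \<open>N(\<alpha>) = \<Sum>\<^sub>j w(j) \<alpha>\<^sub>j\<close>. Taking
  powers of a large \<open>K\<close> as weights makes \<open>N\<close> injective on the exponents of \<open>p\<close>, so no terms
  merge; the univariate polynomial has infinitely many roots, and \<open>a\<^sup>\<alpha> \<noteq> 0\<close> because no coordinate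
  of \<open>a\<close> is zero.
\<close>

lemma poly_zero_on_open:
  fixes p :: "'n::finite rpoly"
  assumes "open U" "U \<noteq> {}" and zero: "\<And>x. x \<in> U \<Longrightarrow> poly_eval p x = 0"
  shows "p = 0"
proof -
  obtain a where a: "a \<in> U" "\<And>j. vec_nth a j \<noteq> 0"
    using open_meets_nonzero_coordinates[OF assms(1,2)] by blast
  obtain g :: "'n \<Rightarrow> nat" where g: "bij_betw g UNIV {0..<CARD('n)}"
    using ex_bij_betw_finite_nat[OF finite_class.finite_UNIV] by blast
  define K where "K = Suc (\<Sum>\<alpha>\<in>Poly_Mapping.keys p. \<Sum>j\<in>UNIV. Poly_Mapping.lookup \<alpha> j)"
  have small: "Poly_Mapping.lookup \<alpha> j < K" if "\<alpha> \<in> Poly_Mapping.keys p" for \<alpha> j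
  proof -
    have "Poly_Mapping.lookup \<alpha> j \<le> (\<Sum>j\<in>UNIV. Poly_Mapping.lookup \<alpha> j)"
      by (intro member_le_sum) auto
    also have "\<dots> \<le> (\<Sum>\<alpha>\<in>Poly_Mapping.keys p. \<Sum>j\<in>UNIV. Poly_Mapping.lookup \<alpha> j)"
      using that by (intro member_le_sum) auto
    finally show ?thesis by (simp add: K_def)
  qed
  define N where "N \<alpha> = (\<Sum>j\<in>UNIV. K ^ g j * Poly_Mapping.lookup \<alpha> j)" for \<alpha> :: "'n exponent"
  have N_digits: "N \<alpha> = (\<Sum>i<CARD('n). K ^ i * Poly_Mapping.lookup \<alpha> (inv_into UNIV g i))" for \<alpha>
    using sum.reindex_bij_betw[OF g, of "\<lambda>i. K ^ i * Poly_Mapping.lookup \<alpha> (inv_into UNIV g i)"] g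
    by (simp add: N_def bij_betw_def lessThan_atLeast0)
  have inj: "inj_on N (Poly_Mapping.keys p)"
  proof (rule inj_onI, rule poly_mapping_eqI)
    fix \<alpha> \<beta> j
    assume ab: "\<alpha> \<in> Poly_Mapping.keys p" "\<beta> \<in> Poly_Mapping.keys p" "N \<alpha> = N \<beta>"
    have "g j < CARD('n)" using g by (auto simp: bij_betw_def)
    from digit_sum_inject[OF _ _ ab(3)[unfolded N_digits] this]
    have "Poly_Mapping.lookup \<alpha> (inv_into UNIV g (g j)) = Poly_Mapping.lookup \<beta> (inv_into UNIV g (g j))"
      using small ab(1,2) by blast
    then show "Poly_Mapping.lookup \<alpha> j = Poly_Mapping.lookup \<beta> j"
      using g by (simp add: bij_betw_def)
  qed
  define curve where "curve t = vec_lambda (\<lambda>j. vec_nth a j * t ^ (K ^ g j))" for t :: real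
  have curve_monom: "monom_eval \<alpha> (curve t) = monom_eval \<alpha> a * t ^ N \<alpha>" for \<alpha> t
    by (simp add: monom_eval_def curve_def N_def power_mult_distrib prod.distrib power_sum power_mult)
  define Q where "Q = (\<Sum>\<alpha>\<in>Poly_Mapping.keys p.
                         monom (Poly_Mapping.lookup p \<alpha> * monom_eval \<alpha> a) (N \<alpha>))"
  have poly_Q: "poly Q t = poly_eval p (curve t)" for t
    by (simp add: Q_def poly_sum poly_monom poly_eval_def curve_monom mult.assoc)
  have "continuous_on UNIV curve"
    unfolding curve_def by (intro continuous_intros)
  then have "open (curve -` U)"
    using assms(1) by (simp add: open_vimage)
  moreover have "curve 1 = a" by (simp add: curve_def vec_eq_iff)
  then have "1 \<in> curve -` U" using a(1) by simp
  ultimately have "infinite (curve -` U)"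
    using finite_imp_not_open by blast
  moreover have "curve -` U \<subseteq> {t. poly Q t = 0}"
    using zero by (auto simp: poly_Q)
  ultimately have "Q = 0"
    using poly_roots_finite finite_subset by blast
  have "\<alpha> \<notin> Poly_Mapping.keys p" for \<alpha>
  proof
    assume \<alpha>: "\<alpha> \<in> Poly_Mapping.keys p"
    have "coeff Q (N \<alpha>) = (\<Sum>\<beta>\<in>Poly_Mapping.keys p.
             if \<beta> = \<alpha> then Poly_Mapping.lookup p \<beta> * monom_eval \<beta> a else 0)"
      unfolding Q_def coeff_sum coeff_monom
      using inj \<alpha> by (intro sum.cong) (auto simp: inj_on_eq_iff)
    then have "coeff Q (N \<alpha>) = Poly_Mapping.lookup p \<alpha> * monom_eval \<alpha> a"
      using \<alpha> by simp
    then have "Poly_Mapping.lookup p \<alpha> = 0"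
      using \<open>Q = 0\<close> a(2) by (simp add: monom_eval_def)
    then show False using \<alpha> by (simp add: in_keys_iff)
  qed
  then show ?thesis by (metis all_not_in_conv keys_eq_empty)
qed

section \<open>Square-integrable functions and continuous functions on the support\<close>

text \<open>
  The product is dominated by \<open>f\<^sup>2 + g\<^sup>2\<close>.
\<close>

lemma square_integrable_mult:
  assumes "square_integrable M f" "square_integrable M g"
  shows "integrable M (\<lambda>x. f x * g x)"
proof (rule Bochner_Integration.integrable_bound)
  show "integrable M (\<lambda>x. (f x)\<^sup>2 + (g x)\<^sup>2)"
    using assms by (simp add: square_integrable_def)
  show "(\<lambda>x. f x * g x) \<in> borel_measurable M"
    using assms by (intro borel_measurable_times) (auto simp: square_integrable_def)
  have "\<bar>s * t\<bar> \<le> s\<^sup>2 + t\<^sup>2" for s t :: real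
  proof -
    have "2 * \<bar>s\<bar> * \<bar>t\<bar> \<le> s\<^sup>2 + t\<^sup>2" using sum_squares_bound[of "\<bar>s\<bar>" "\<bar>t\<bar>"] by simp
    moreover have "0 \<le> \<bar>s\<bar> * \<bar>t\<bar>" by simp
    ultimately show ?thesis unfolding abs_mult by linarith
  qed
  then show "AE x in M. norm (f x * g x) \<le> norm ((f x)\<^sup>2 + (g x)\<^sup>2)"
    by (auto simp: abs_of_nonneg)
qed

lemma space_of_restricted_borel:
  assumes "sets M = sets (restrict_space borel \<Omega>)"
  shows "space M = \<Omega>"
  using sets_eq_imp_space_eq[OF assms] by (simp add: space_restrict_space)

lemma square_integrable_continuous:
  fixes f :: "'a::topological_space \<Rightarrow> real"
  assumes "compact \<Omega>" "sets M = sets (restrict_space borel \<Omega>)" "finite_measure M"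
    and cont: "continuous_on UNIV f"
  shows "square_integrable M f"
proof -
  interpret finite_measure M by fact
  have "f \<in> borel_measurable (restrict_space borel \<Omega>)"
    using cont by (intro measurable_restrict_space1 borel_measurable_continuous_onI)
  then have meas: "f \<in> borel_measurable M"
    using measurable_cong_sets[OF assms(2) refl] by blast
  have "compact (f ` \<Omega>)"
    using cont assms(1) by (intro compact_continuous_image) (auto intro: continuous_on_subset)
  then obtain B where B: "\<And>x. x \<in> \<Omega> \<Longrightarrow> \<bar>f x\<bar> \<le> B"
    by (metis bounded_iff compact_imp_bounded imageI real_norm_def)
  have "integrable M (\<lambda>x. (f x)\<^sup>2)"
  proof (rule integrable_const_bound[where B = "B\<^sup>2"])
    show "AE x in M. norm ((f x)\<^sup>2) \<le> B\<^sup>2"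
      using power_mono[OF B, of _ 2] by (intro AE_I2) (simp add: space_of_restricted_borel[OF assms(2)])
  qed (use meas in simp)
  then show ?thesis using meas by (simp add: square_integrable_def)
qed

text \<open>
  If \<open>f x \<noteq> 0\<close>, the open set where \<open>f\<close> does not vanish is a neighbourhood of \<open>x\<close>, so it has
  positive measure, although \<open>f\<^sup>2\<close> vanishes almost everywhere.
\<close>

lemma zero_on_measure_support:
  fixes f :: "'a::topological_space \<Rightarrow> real"
  assumes "sets M = sets (restrict_space borel \<Omega>)" "continuous_on UNIV f"
    and "square_integrable M f" "(\<integral>x. (f x)\<^sup>2 \<partial>M) = 0" and x: "x \<in> measure_support M"
  shows "f x = 0"
proof (rule ccontr)
  assume "f x \<noteq> 0"
  define U where "U = {x. f x \<noteq> 0}"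
  have "open U"
    unfolding U_def using assms(2) by (intro open_Collect_neq continuous_on_const)
  then have pos: "0 < emeasure M (U \<inter> space M)"
    using x \<open>f x \<noteq> 0\<close> by (auto simp: measure_support_def U_def)
  have meas: "f \<in> borel_measurable M"
    using assms(3) by (simp add: square_integrable_def)
  have "AE x in M. (f x)\<^sup>2 = 0"
    using assms(3,4) integral_nonneg_eq_0_iff_AE[of M "\<lambda>x. (f x)\<^sup>2"]
    by (simp add: square_integrable_def)
  then have "emeasure M {x \<in> space M. f x \<noteq> 0} = 0"
    using meas by (subst (asm) AE_iff_measurable[OF _ refl]) auto
  moreover have "{x \<in> space M. f x \<noteq> 0} = U \<inter> space M" by (auto simp: U_def)
  ultimately show False using pos by simp
qed

section \<open>Quadratic objectives\<close>

lemma is_arg_min_bij_betw: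
  fixes f :: "'a \<Rightarrow> 'c::linordered_ab_group_add"
  assumes h: "bij_betw h {x. P x} {y. Q y}" and x: "P x"
    and shift: "\<And>x. P x \<Longrightarrow> f x = k + g (h x)"
  shows "is_arg_min f P x \<longleftrightarrow> is_arg_min g Q (h x)"
proof -
  have Q: "Q y \<longleftrightarrow> (\<exists>x. P x \<and> y = h x)" for y
    using h by (auto simp: bij_betw_def)
  show ?thesis
    using x shift by (auto simp: is_arg_min_def Q)
qed

text \<open>
  Completing the square: the terms linear in \<open>w\<close> cancel because \<open>A\<close> is symmetric and the
  linear coefficient of the objective is \<open>A c\<close>.
\<close>

lemma quad_objective_shift:
  assumes A: "A \<in> carrier_mat n n" "transpose_mat A = A"
    and c: "c \<in> carrier_vec n" and w: "w \<in> carrier_vec n"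
  shows "quad_objective A (A *\<^sub>v c) (c + w) = quad_objective A (A *\<^sub>v c) c + w \<bullet> (A *\<^sub>v w)"
proof -
  have Ac: "A *\<^sub>v c \<in> carrier_vec n" and Aw: "A *\<^sub>v w \<in> carrier_vec n"
    using A(1) c w by auto
  have "c \<bullet> (A *\<^sub>v w) = w \<bullet> (A *\<^sub>v c)"
    using transpose_vec_mult_scalar[OF A(1) w c] comm_scalar_prod[OF w Ac] A(2) by simp
  then show ?thesis
    using c w Ac Aw
    by (simp add: quad_objective_def mult_add_distrib_mat_vec[OF A(1)]
        add_scalar_prod_distrib[of _ n] scalar_prod_add_distrib[of _ n])
qed

lemma positive_definite_unique_minimizer:
  assumes A: "A \<in> carrier_mat n n" "transpose_mat A = A"
    and pos: "\<And>w. w \<in> carrier_vec n \<Longrightarrow> w \<noteq> 0\<^sub>v n \<Longrightarrow> 0 < w \<bullet> (A *\<^sub>v w)"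
    and c: "c \<in> carrier_vec n"
  shows "is_arg_min (quad_objective A (A *\<^sub>v c)) (\<lambda>v. v \<in> carrier_vec n) v \<longleftrightarrow> v = c"
proof -
  have less: "quad_objective A (A *\<^sub>v c) c < quad_objective A (A *\<^sub>v c) v"
    if v: "v \<in> carrier_vec n" "v \<noteq> c" for v
  proof -
    have eq: "c + (v - c) = v" using v c by (intro eq_vecI) auto
    have "v - c \<noteq> 0\<^sub>v n"
      using v c eq by auto
    then have "0 < (v - c) \<bullet> (A *\<^sub>v (v - c))"
      using pos v c by auto
    then show ?thesis
      using quad_objective_shift[OF A c, of "v - c"] v c unfolding eq by simp
  qed
  show ?thesis
  proof
    assume "is_arg_min (quad_objective A (A *\<^sub>v c)) (\<lambda>v. v \<in> carrier_vec n) v"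
    then show "v = c" using less c by (auto simp: is_arg_min_def)
  next
    assume "v = c"
    then show "is_arg_min (quad_objective A (A *\<^sub>v c)) (\<lambda>v. v \<in> carrier_vec n) v"
      using less c by (fastforce simp: is_arg_min_def)
  qed
qed

text \<open>
  A nonzero vector in the kernel of \<open>A\<close> would make the quadratic form vanish.
\<close>

lemma positive_definite_mat_inverse:
  fixes A :: "real mat"
  assumes A: "A \<in> carrier_mat n n"
    and pos: "\<And>w. w \<in> carrier_vec n \<Longrightarrow> w \<noteq> 0\<^sub>v n \<Longrightarrow> 0 < w \<bullet> (A *\<^sub>v w)"
  obtains B where "mat_inverse A = Some B" "A * B = 1\<^sub>m n" "B * A = 1\<^sub>m n" "B \<in> carrier_mat n n"
proof -
  have "det A \<noteq> 0"
  proof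
    assume "det A = 0"
    then obtain w where w: "w \<in> carrier_vec n" "w \<noteq> 0\<^sub>v n" "A *\<^sub>v w = 0\<^sub>v n"
      using det_0_iff_vec_prod_zero[OF A] by blast
    then show False using pos[OF w(1,2)] by simp
  qed
  then have "A \<in> Units (ring_mat TYPE(real) n ())"
    by (rule det_non_zero_imp_unit[OF A])
  then obtain B where "mat_inverse A = Some B"
    using mat_inverse(1)[OF A, of "()"] by (cases "mat_inverse A") auto
  then show thesis using mat_inverse(2)[OF A] that by blast
qed

section \<open>The moment matrix as a Gram matrix\<close>

lemma sum_nth_distinct:
  assumes "distinct as"
  shows "(\<Sum>i = 0..<length as. f (as ! i)) = (\<Sum>\<alpha>\<in>set as. f \<alpha>)"
  using sum.reindex_bij_betw[OF bij_betw_nth[OF assms refl refl], of f]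
  by (simp add: lessThan_atLeast0)

lemma family_vec_scalar_prod:
  assumes "distinct as"
  shows "family_vec as f \<bullet> family_vec as g = (\<Sum>\<alpha>\<in>set as. f \<alpha> * g \<alpha>)"
  using sum_nth_distinct[OF assms, of "\<lambda>\<alpha>. f \<alpha> * g \<alpha>"]
  by (simp add: scalar_prod_def family_vec_def)

lemma moment_matrix_mult_family_vec:
  assumes "distinct as"
  shows "moment_matrix as z *\<^sub>v family_vec as f
         = family_vec as (\<lambda>\<alpha>. \<Sum>\<beta>\<in>set as. z (\<alpha> + \<beta>) * f \<beta>)"
  using sum_nth_distinct[OF assms, of "\<lambda>\<beta>. z (\<alpha> + \<beta>) * f \<beta>" for \<alpha>]
  by (intro eq_vecI) (auto simp: moment_matrix_def family_vec_def scalar_prod_def)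

lemma moment_matrix_carrier: "moment_matrix as z \<in> carrier_mat (length as) (length as)"
  by (simp add: moment_matrix_def)

lemma transpose_moment_matrix: "transpose_mat (moment_matrix as z) = moment_matrix as z"
  by (intro eq_matI) (auto simp: moment_matrix_def add.commute)

lemma coeff_vec_surj:
  assumes "distinct as" "set as = exponents_le d" and v: "v \<in> carrier_vec (length as)"
  obtains p where "p \<in> polys_le d" "coeff_vec as p = v"
proof -
  have "v \<in> coeff_vec as ` polys_le d"
    using bij_betw_imp_surj_on[OF bij_betw_coeff_vec[OF assms(1,2)]] v by simp
  then show thesis using that by blast
qed

text \<open>
  Square integrability of all polynomials is what the Gram identities require of the measure:
  it makes the integrals below finite and lets sums be exchanged with integrals.
\<close>

context
  fixes M :: "(real ^ 'n::finite) measure" and as :: "'n exponent list" and d :: nat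
  assumes polys: "\<And>p. square_integrable M (poly_eval (p :: 'n rpoly))"
    and monoms: "\<And>\<alpha>. square_integrable M (monom_eval (\<alpha> :: 'n exponent))"
    and as: "distinct as" "set as = exponents_le d"
begin

lemma poly_eval_enum:
  assumes "p \<in> polys_le d"
  shows "poly_eval p x = (\<Sum>\<alpha>\<in>set as. Poly_Mapping.lookup p \<alpha> * monom_eval \<alpha> x)"
  unfolding as(2) using assms by (intro poly_eval_superset card_exponents_le(1)) (simp add: polys_le_def)

text \<open>
  Row \<open>\<alpha>\<close> of the product is \<open>\<Sum>\<^sub>\<beta> z\<^bsub>\<alpha>+\<beta>\<^esub> p\<^sub>\<beta>\<close>, and \<open>z\<^bsub>\<alpha>+\<beta>\<^esub>\<close> is the inner product of the monomials
  \<open>x\<^sup>\<alpha>\<close> and \<open>x\<^sup>\<beta>\<close>; this is where the Hankel-type structure of the moment matrix enters.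
\<close>

lemma moment_matrix_mult_coeff_vec:
  assumes "p \<in> polys_le d"
  shows "moment_matrix as (moment M) *\<^sub>v coeff_vec as p
         = family_vec as (\<lambda>\<alpha>. \<integral>x. monom_eval \<alpha> x * poly_eval p x \<partial>M)"
proof -
  have "(\<integral>x. monom_eval \<alpha> x * poly_eval p x \<partial>M)
        = (\<Sum>\<beta>\<in>set as. moment M (\<alpha> + \<beta>) * Poly_Mapping.lookup p \<beta>)" for \<alpha>
  proof -
    have "(\<integral>x. monom_eval \<alpha> x * poly_eval p x \<partial>M)
          = (\<integral>x. (\<Sum>\<beta>\<in>set as. monom_eval \<alpha> x * monom_eval \<beta> x * Poly_Mapping.lookup p \<beta>) \<partial>M)"
      unfolding poly_eval_enum[OF assms] by (simp add: sum_distrib_left mult_ac)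
    also have "\<dots> = (\<Sum>\<beta>\<in>set as. moment M (\<alpha> + \<beta>) * Poly_Mapping.lookup p \<beta>)"
      using square_integrable_mult[OF monoms monoms]
      by (subst Bochner_Integration.integral_sum) (auto simp: moment_def monom_eval_add)
    finally show ?thesis .
  qed
  then show ?thesis
    unfolding coeff_vec_def moment_matrix_mult_family_vec[OF as(1)] by simp
qed

lemma coeff_vec_scalar_prod_integrals:
  assumes "p \<in> polys_le d" "square_integrable M f"
  shows "coeff_vec as p \<bullet> family_vec as (\<lambda>\<alpha>. \<integral>x. monom_eval \<alpha> x * f x \<partial>M)
         = (\<integral>x. poly_eval p x * f x \<partial>M)"
proof -
  have "(\<integral>x. poly_eval p x * f x \<partial>M)
        = (\<integral>x. (\<Sum>\<alpha>\<in>set as. Poly_Mapping.lookup p \<alpha> * (monom_eval \<alpha> x * f x)) \<partial>M)"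
    unfolding poly_eval_enum[OF assms(1)] by (simp add: sum_distrib_right mult.assoc)
  also have "\<dots> = (\<Sum>\<alpha>\<in>set as. Poly_Mapping.lookup p \<alpha> * (\<integral>x. monom_eval \<alpha> x * f x \<partial>M))"
    using square_integrable_mult[OF monoms assms(2)]
    by (subst Bochner_Integration.integral_sum) auto
  finally show ?thesis
    by (simp add: coeff_vec_def family_vec_scalar_prod[OF as(1)])
qed

lemma moment_matrix_quadratic_form:
  assumes "p \<in> polys_le d"
  shows "coeff_vec as p \<bullet> (moment_matrix as (moment M) *\<^sub>v coeff_vec as p)
         = (\<integral>x. (poly_eval p x)\<^sup>2 \<partial>M)"
  using coeff_vec_scalar_prod_integrals[OF assms polys, of p] moment_matrix_mult_coeff_vec[OF assms]
  by (simp add: power2_eq_square)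

lemma L2_distance_eq_quad_objective:
  assumes p: "p \<in> polys_le d" and u: "square_integrable M u"
  shows "(L2_norm M (\<lambda>x. u x - poly_eval p x))\<^sup>2
         = (\<integral>x. (u x)\<^sup>2 \<partial>M)
           + quad_objective (moment_matrix as (moment M))
               (family_vec as (\<lambda>\<alpha>. \<integral>x. monom_eval \<alpha> x * u x \<partial>M)) (coeff_vec as p)"
proof -
  have int: "integrable M (\<lambda>x. (u x)\<^sup>2)" "integrable M (\<lambda>x. (poly_eval p x)\<^sup>2)"
    "integrable M (\<lambda>x. poly_eval p x * u x)"
    using u polys[of p] square_integrable_mult[OF polys u] by (auto simp: square_integrable_def)
  have "(L2_norm M (\<lambda>x. u x - poly_eval p x))\<^sup>2
        = (\<integral>x. (u x)\<^sup>2 + (poly_eval p x)\<^sup>2 - 2 * (poly_eval p x * u x) \<partial>M)"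
    unfolding L2_norm_squared by (simp add: power2_diff mult_ac)
  also have "\<dots> = (\<integral>x. (u x)\<^sup>2 \<partial>M) + (\<integral>x. (poly_eval p x)\<^sup>2 \<partial>M) - 2 * (\<integral>x. poly_eval p x * u x \<partial>M)"
    using int by simp
  finally show ?thesis
    unfolding quad_objective_def moment_matrix_quadratic_form[OF p]
      coeff_vec_scalar_prod_integrals[OF p u] by simp
qed

text \<open>
  The quadratic form at the coefficients of \<open>p\<close> is \<open>\<integral>p\<^sup>2\<close>, so definiteness of the matrix is
  definiteness of the mean-square seminorm on polynomials; the hypothesis \<open>definite\<close> is the
  only place where the geometry of the support enters.
\<close>

lemma moment_matrix_positive_definite:
  assumes definite: "\<And>p :: 'n rpoly. (\<integral>x. (poly_eval p x)\<^sup>2 \<partial>M) = 0 \<Longrightarrow> p = 0"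
    and v: "v \<in> carrier_vec (length as)" "v \<noteq> 0\<^sub>v (length as)"
  shows "0 < v \<bullet> (moment_matrix as (moment M) *\<^sub>v v)"
proof -
  obtain p where p: "p \<in> polys_le d" "coeff_vec as p = v"
    using coeff_vec_surj[OF as v(1)] by blast
  have "p \<noteq> 0"
  proof
    assume "p = 0"
    then have "v = 0\<^sub>v (length as)"
      unfolding p(2)[symmetric] by (intro eq_vecI) (auto simp: coeff_vec_def family_vec_def)
    then show False using v(2) by simp
  qed
  then have "(\<integral>x. (poly_eval p x)\<^sup>2 \<partial>M) \<noteq> 0"
    using definite by blast
  then have "0 < (\<integral>x. (poly_eval p x)\<^sup>2 \<partial>M)"
    by (simp add: order_less_le)
  then show ?thesis
    using moment_matrix_quadratic_form[OF p(1)] p(2) by simp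
qed

end

section \<open>Best polynomial approximation in mean square\<close>

theorem proposition1:
  fixes \<Omega> :: "(real ^ 'n::finite) set"
    and lam :: "(real ^ 'n) measure"
    and u :: "real ^ 'n \<Rightarrow> real"
    and d :: nat
    and as :: "'n exponent list"
    and y :: "'n exponent \<Rightarrow> real"
  assumes "compact \<Omega>" and "interior \<Omega> \<noteq> {}"
    and "sets lam = sets (restrict_space borel \<Omega>)" and "finite_measure lam"
    and "measure_support lam = \<Omega>"
    and "\<exists>U. open U \<and> U \<subseteq> \<Omega> \<and> 0 < emeasure lam U"
    and "square_integrable lam u" and "AE x in lam. 0 \<le> u x"
    and "distinct as" and "set as = exponents_le d"
    and "\<And>\<alpha>. \<alpha> \<in> exponents_le d \<Longrightarrow> y \<alpha> = (\<integral>x. monom_eval \<alpha> x * u x \<partial>lam)"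
  shows
    "(\<forall>p \<in> polys_le d.
        is_arg_min (\<lambda>q. (L2_norm lam (\<lambda>x. u x - poly_eval q x))\<^sup>2) (\<lambda>q. q \<in> polys_le d) p
        \<longleftrightarrow> is_arg_min (quad_objective (moment_matrix as (moment lam)) (family_vec as y))
              (\<lambda>v. v \<in> carrier_vec (length as)) (coeff_vec as p))
     \<and> invertible_mat (moment_matrix as (moment lam))
     \<and> (\<exists>Minv ustar p.
          mat_inverse (moment_matrix as (moment lam)) = Some Minv
          \<and> ustar = Minv *\<^sub>v family_vec as y
          \<and> (\<forall>v. is_arg_min (quad_objective (moment_matrix as (moment lam)) (family_vec as y))
                    (\<lambda>v. v \<in> carrier_vec (length as)) v \<longleftrightarrow> v = ustar)
          \<and> p \<in> polys_le d \<and> coeff_vec as p = ustar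
          \<and> (\<forall>\<alpha> \<in> exponents_le d.
                (\<integral>x. monom_eval \<alpha> x * poly_eval p x \<partial>lam) = y \<alpha>
                \<and> y \<alpha> = (\<integral>x. monom_eval \<alpha> x * u x \<partial>lam)))"
proof -
  let ?M = "moment_matrix as (moment lam)"
  let ?n = "length as"
  let ?b = "family_vec as y"
  note sets = \<open>sets lam = sets (restrict_space borel \<Omega>)\<close>
  note as = \<open>distinct as\<close> \<open>set as = exponents_le d\<close>
  note u = \<open>square_integrable lam u\<close>
  have cont: "square_integrable lam f" if "continuous_on UNIV f" for f
    using square_integrable_continuous[OF \<open>compact \<Omega>\<close> sets \<open>finite_measure lam\<close> that] .
  have polys: "square_integrable lam (poly_eval p)" for p :: "'n rpoly"
    by (intro cont continuous_intros)
  have monoms: "square_integrable lam (monom_eval \<alpha>)" for \<alpha> :: "'n exponent"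
    by (intro cont continuous_intros)
  have definite: "p = 0" if "(\<integral>x. (poly_eval p x)\<^sup>2 \<partial>lam) = 0" for p :: "'n rpoly"
  proof (rule poly_zero_on_open)
    show "open (interior \<Omega>)" "interior \<Omega> \<noteq> {}" using assms by auto
    show "poly_eval p x = 0" if "x \<in> interior \<Omega>" for x
      using zero_on_measure_support[OF sets continuous_on_poly_eval polys \<open>_ = 0\<close>, of x]
        \<open>measure_support lam = \<Omega>\<close> that interior_subset by blast
  qed
  have M: "?M \<in> carrier_mat ?n ?n" "transpose_mat ?M = ?M"
    by (rule moment_matrix_carrier, rule transpose_moment_matrix)
  have pos: "0 < w \<bullet> (?M *\<^sub>v w)" if "w \<in> carrier_vec ?n" "w \<noteq> 0\<^sub>v ?n" for w
    using moment_matrix_positive_definite[OF polys monoms as definite that] .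
  have b: "?b = family_vec as (\<lambda>\<alpha>. \<integral>x. monom_eval \<alpha> x * u x \<partial>lam)"
    unfolding family_vec_def using assms(11) as(2) nth_mem by (intro eq_vecI) auto
  have b_carrier: "?b \<in> carrier_vec ?n" by (simp add: family_vec_def)
  obtain Minv where Minv: "mat_inverse ?M = Some Minv" "?M * Minv = 1\<^sub>m ?n" "Minv * ?M = 1\<^sub>m ?n"
    "Minv \<in> carrier_mat ?n ?n"
    using positive_definite_mat_inverse[OF M(1) pos] by blast
  define ustar where "ustar = Minv *\<^sub>v ?b"
  have ustar: "ustar \<in> carrier_vec ?n"
    using Minv(4) b_carrier by (simp add: ustar_def)
  have M_ustar: "?M *\<^sub>v ustar = ?b"
    unfolding ustar_def
    using assoc_mult_mat_vec[OF M(1) Minv(4) b_carrier] Minv(2) b_carrier by simp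
  obtain p where p: "p \<in> polys_le d" "coeff_vec as p = ustar"
    using coeff_vec_surj[OF as ustar] by blast
  have unique: "is_arg_min (quad_objective ?M ?b) (\<lambda>v. v \<in> carrier_vec ?n) v \<longleftrightarrow> v = ustar" for v
    using positive_definite_unique_minimizer[OF M pos ustar, of v] unfolding M_ustar .
  have moments: "(\<integral>x. monom_eval \<alpha> x * poly_eval p x \<partial>lam) = y \<alpha>" if \<alpha>: "\<alpha> \<in> exponents_le d" for \<alpha>
  proof -
    obtain i where i: "i < ?n" "as ! i = \<alpha>"
      using \<alpha> as(2) by (metis in_set_conv_nth)
    have "family_vec as (\<lambda>\<alpha>. \<integral>x. monom_eval \<alpha> x * poly_eval p x \<partial>lam) = ?b"
      using moment_matrix_mult_coeff_vec[OF polys monoms as p(1)] M_ustar p(2) by simp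
    from arg_cong[OF this, of "\<lambda>v. v $ i"] show ?thesis
      using i by (simp add: family_vec_def)
  qed
  have "is_arg_min (\<lambda>q. (L2_norm lam (\<lambda>x. u x - poly_eval q x))\<^sup>2) (\<lambda>q. q \<in> polys_le d) q
        \<longleftrightarrow> is_arg_min (quad_objective ?M ?b) (\<lambda>v. v \<in> carrier_vec ?n) (coeff_vec as q)"
    if "q \<in> polys_le d" for q
  proof (rule is_arg_min_bij_betw)
    show "bij_betw (coeff_vec as) {q. q \<in> polys_le d} {v. v \<in> carrier_vec ?n}"
      using bij_betw_coeff_vec[OF as] by simp
    show "(L2_norm lam (\<lambda>x. u x - poly_eval q x))\<^sup>2
          = (\<integral>x. (u x)\<^sup>2 \<partial>lam) + quad_objective ?M ?b (coeff_vec as q)"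
      if "q \<in> polys_le d" for q
      unfolding b by (rule L2_distance_eq_quad_objective[OF polys monoms as that u])
  qed (fact that)
  moreover have "invertible_mat ?M"
    using M(1) Minv unfolding invertible_mat_def inverts_mat_def by auto
  ultimately show ?thesis
    using Minv(1) ustar_def unique p moments assms(11) by blast
qed

end
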